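(* Let $A$ be a non-empty closed subset of $E^{n}$. If there is a point $p\in A$ that sees every point of $\partial A$ via $A$, then $A$ is starshaped.
   Context: $E^{n}$ is the $n$-dimensional Euclidean space, $n\ge 1$, and $\partial A$ denotes the boundary of $A$. A point $x\in A$ sees $y\in A$ via $A$ if the closed segment $[xy]$ joining $x$ and $y$ is contained in $A$. A set $A$ is starshaped if there is some point $x\in A$ that sees each point of $A$ via $A$. *)

theory Defs
  imports "HOL-Analysis.Analysis"
begin

(* Membership of both points in A is implied: they are the endpoints of the segment. *)
definition sees_via :: "'a::real_vector set \<Rightarrow> 'a \<Rightarrow> 'a \<Rightarrow> bool" where
  "sees_via A x y \<longleftrightarrow> closed_segment x y \<subseteq> A"

end

theory Submission
  imports Defs
begin

text \<open>The point \<open>p\<close> itself sees all of \<open>A\<close>. If a segment from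
  \<open>p\<close> to a point \<open>x\<close> of \<open>A\<close> left \<open>A\<close> at
  \<open>y\<close>, then on its way back from \<open>y\<close> to \<open>x\<close> it would cross
  the boundary at some \<open>z\<close>; but \<open>y\<close> lies on the segment from
  \<open>p\<close> to \<open>z\<close>, which is in \<open>A\<close>.\<close>

theorem proposition7:
  fixes A :: "(real ^ 'n) set"
  assumes "A \<noteq> {}" and "closed A"
    and "\<exists>p\<in>A. \<forall>x\<in>frontier A. sees_via A p x"
  shows "starlike A"
proof -
  obtain p where p: "p \<in> A" and sees: "\<And>z. z \<in> frontier A \<Longrightarrow> closed_segment p z \<subseteq> A"
    using assms(3) unfolding sees_via_def by blast
  have "closed_segment p x \<subseteq> A" if x: "x \<in> A" for x
  proof (rule ccontr)
    assume "\<not> closed_segment p x \<subseteq> A"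
    then obtain y where y: "y \<in> closed_segment p x" "y \<notin> A" by blast
    \<comment> \<open>A connected set meeting both \<open>A\<close> and its complement meets the
      frontier.\<close>
    have "closed_segment y x \<inter> frontier A \<noteq> {}"
      using x y(2) by (intro connected_Int_frontier) auto
    then obtain z where z: "z \<in> closed_segment y x" "z \<in> frontier A" by blast
    \<comment> \<open>The order along the segment is \<open>p\<close>, \<open>y\<close>,
      \<open>z\<close>, \<open>x\<close>, so \<open>y\<close> blocks the view of \<open>z\<close>
      from \<open>p\<close>.\<close>
    have "y \<in> closed_segment p z"
      using between_trans_2[of x p y z] y(1) z(1)
      by (simp add: between_mem_segment closed_segment_commute)
    with sees[OF z(2)] y(2) show False by blast
  qed
  with p show ?thesis unfolding starlike_def by blast
qed

end
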